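(* Let $X$ be a locally compact $T_0$ space such that $\mathord{\downarrow}(K\cap A)$ is closed in $X$ for every $A\in\mathbf{KF}(X)$ and every compact saturated subset $K\in Q(X)$. Then the $D$-completion of $X$ coincides with the sobrification of $X$.
   Context: For a $T_0$ space $X$, the specialization order is $x\le y$ iff $x\in cl(\{y\})$; $\mathord{\downarrow}$ and $\mathord{\uparrow}$ refer to it. $\Gamma(X)$ is the set of closed subsets of $X$, and $Q(X)$ the set of compact saturated subsets (saturated means $K=\mathord{\uparrow}K$). A family $\mathfrak K\subseteq Q(X)$ is filtered if it is nonempty and any two members contain a common member. A nonempty set $A\subseteq X$ is a $KF$-set if there is a filtered family $\mathfrak K\subseteq Q(X)$ such that $cl(A)$ is minimal among the closed sets that intersect all members of $\mathfrak K$; $\mathbf{KF}(X)$ is the set of closed $KF$-sets. $X$ is locally compact if for every $x\in X$ and open $U\ni x$ there is a compact saturated $Q$ with $x\in\mathrm{int}(Q)$ and $Q\subseteq U$. The lower Vietoris topology on a family of closed sets has as subbasis the sets $\diamondsuit U=\{A: A\cap U\neq\emptyset\}$, $U$ open in $X$. The sobrification of $X$ is the set $\mathbf{IRR}(X)$ of (nonempty) irreducible closed subsets with the lower Vietoris topology, with embedding $x\mapsto\mathord{\downarrow}x=cl(\{x\})$. A monotone convergence space is a $T_0$ space in which the closure of every directed set (in the specialization order) is the closure of a unique point. A subset of a poset is $d$-closed if it contains the supremum (when it exists) of each of its directed subsets; $cl_d(B)$ is the smallest $d$-closed set containing $B$. A $D$-completion of $X$ is a monotone convergence space $Y$ with a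 topological embedding $j:X\to Y$ such that $cl_d(j(X))=Y$. It is unique up to homeomorphism; its standard form is the $d$-closure of $\{\mathord{\downarrow}x:x\in X\}$ in $(\Gamma(X),\subseteq)$ with the lower Vietoris topology, and it is contained in $\mathbf{IRR}(X)$. "Coincides" means that this subset of $\Gamma(X)$ equals $\mathbf{IRR}(X)$. *)

theory Defs
  imports "HOL-Analysis.Analysis"
begin

section \<open>Specialization order, saturated sets\<close>

definition spec_le :: "'a topology \<Rightarrow> 'a \<Rightarrow> 'a \<Rightarrow> bool" where
  "spec_le X x y \<longleftrightarrow> x \<in> topspace X \<and> y \<in> topspace X \<and> x \<in> X closure_of {y}"

definition down :: "'a topology \<Rightarrow> 'a set \<Rightarrow> 'a set" where
  "down X A = {x. \<exists>a\<in>A. spec_le X x a}"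

definition up :: "'a topology \<Rightarrow> 'a set \<Rightarrow> 'a set" where
  "up X A = {x. \<exists>a\<in>A. spec_le X a x}"

definition Gamma :: "'a topology \<Rightarrow> 'a set set" where
  "Gamma X = {A. closedin X A}"

definition Q :: "'a topology \<Rightarrow> 'a set set" where
  "Q X = {K. compactin X K \<and> K = up X K}"

text \<open>The library predicate \<^const>\<open>locally_compact_space\<close> only asks for one compact neighbourhood
  of each point; without a separation axiom this is weaker than the following.\<close>

definition locally_compact_sat :: "'a topology \<Rightarrow> bool" where
  "locally_compact_sat X \<longleftrightarrow>
     (\<forall>x\<in>topspace X. \<forall>U. openin X U \<and> x \<in> U \<longrightarrow> (\<exists>K\<in>Q X. x \<in> X interior_of K \<and> K \<subseteq> U))"


section \<open>KF-sets and irreducible closed sets\<close>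

definition filtered_family :: "'a topology \<Rightarrow> 'a set set \<Rightarrow> bool" where
  "filtered_family X \<K> \<longleftrightarrow>
     \<K> \<subseteq> Q X \<and> \<K> \<noteq> {} \<and> (\<forall>K1\<in>\<K>. \<forall>K2\<in>\<K>. \<exists>K3\<in>\<K>. K3 \<subseteq> K1 \<inter> K2)"

definition minimal_hitting :: "'a topology \<Rightarrow> 'a set set \<Rightarrow> 'a set \<Rightarrow> bool" where
  "minimal_hitting X \<K> C \<longleftrightarrow>
     closedin X C \<and> (\<forall>K\<in>\<K>. C \<inter> K \<noteq> {}) \<and>
     (\<forall>B. closedin X B \<and> (\<forall>K\<in>\<K>. B \<inter> K \<noteq> {}) \<and> B \<subseteq> C \<longrightarrow> B = C)"

definition KF_set :: "'a topology \<Rightarrow> 'a set \<Rightarrow> bool" where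
  "KF_set X A \<longleftrightarrow> A \<noteq> {} \<and> A \<subseteq> topspace X \<and>
     (\<exists>\<K>. filtered_family X \<K> \<and> minimal_hitting X \<K> (X closure_of A))"

definition KF :: "'a topology \<Rightarrow> 'a set set" where
  "KF X = {A. closedin X A \<and> KF_set X A}"

definition IRR :: "'a topology \<Rightarrow> 'a set set" where
  "IRR X = {A. closedin X A \<and> A \<noteq> {} \<and>
     (\<forall>B C. closedin X B \<and> closedin X C \<and> A \<subseteq> B \<union> C \<longrightarrow> A \<subseteq> B \<or> A \<subseteq> C)}"


section \<open>The lower Vietoris topology and the sobrification\<close>

definition diamond :: "'a set set \<Rightarrow> 'a set \<Rightarrow> 'a set set" where
  "diamond \<F> U = {A\<in>\<F>. A \<inter> U \<noteq> {}}"

text \<open>The topology has carrier \<open>\<F>\<close>, also when \<open>\<F>\<close> has the empty set as a member, which lies in no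
  subbasic open set: \<open>finite intersection_of\<close> admits the empty intersection.\<close>

definition lower_Vietoris :: "'a topology \<Rightarrow> 'a set set \<Rightarrow> 'a set topology" where
  "lower_Vietoris X \<F> =
     topology (arbitrary union_of
       (finite intersection_of (\<lambda>S. \<exists>U. openin X U \<and> S = diamond \<F> U) relative_to \<F>))"

definition sobrification :: "'a topology \<Rightarrow> 'a set topology" where
  "sobrification X = lower_Vietoris X (IRR X)"


section \<open>d-closure and the D-completion\<close>

text \<open>A poset is given by a carrier \<open>P\<close> and an order relation \<open>le\<close>.\<close>

definition directed_set :: "('b \<Rightarrow> 'b \<Rightarrow> bool) \<Rightarrow> 'b set \<Rightarrow> bool" where
  "directed_set le D \<longleftrightarrow> D \<noteq> {} \<and> (\<forall>x\<in>D. \<forall>y\<in>D. \<exists>z\<in>D. le x z \<and> le y z)"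

definition is_sup :: "'b set \<Rightarrow> ('b \<Rightarrow> 'b \<Rightarrow> bool) \<Rightarrow> 'b set \<Rightarrow> 'b \<Rightarrow> bool" where
  "is_sup P le D s \<longleftrightarrow>
     s \<in> P \<and> (\<forall>d\<in>D. le d s) \<and> (\<forall>u\<in>P. (\<forall>d\<in>D. le d u) \<longrightarrow> le s u)"

definition d_closed :: "'b set \<Rightarrow> ('b \<Rightarrow> 'b \<Rightarrow> bool) \<Rightarrow> 'b set \<Rightarrow> bool" where
  "d_closed P le C \<longleftrightarrow>
     C \<subseteq> P \<and> (\<forall>D s. D \<subseteq> C \<and> directed_set le D \<and> is_sup P le D s \<longrightarrow> s \<in> C)"

definition d_closure :: "'b set \<Rightarrow> ('b \<Rightarrow> 'b \<Rightarrow> bool) \<Rightarrow> 'b set \<Rightarrow> 'b set" where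
  "d_closure P le B = \<Inter>{C. d_closed P le C \<and> B \<subseteq> C}"

definition monotone_convergence_space :: "'a topology \<Rightarrow> bool" where
  "monotone_convergence_space Y \<longleftrightarrow> t0_space Y \<and>
     (\<forall>D. D \<subseteq> topspace Y \<and> directed_set (spec_le Y) D \<longrightarrow>
        (\<exists>!s. s \<in> topspace Y \<and> Y closure_of D = Y closure_of {s}))"

definition is_D_completion :: "'a topology \<Rightarrow> 'b topology \<Rightarrow> ('a \<Rightarrow> 'b) \<Rightarrow> bool" where
  "is_D_completion X Y j \<longleftrightarrow> monotone_convergence_space Y \<and> embedding_map X Y j \<and>
     d_closure (topspace Y) (spec_le Y) (j ` topspace X) = topspace Y"

text \<open>The standard form of the D-completion; it is shown below to satisfy
  \<^const>\<open>is_D_completion\<close>, which determines it up to homeomorphism.\<close>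

definition D_completion_points :: "'a topology \<Rightarrow> 'a set set" where
  "D_completion_points X = d_closure (Gamma X) (\<subseteq>) ((\<lambda>x. X closure_of {x}) ` topspace X)"

definition D_completion :: "'a topology \<Rightarrow> 'a set topology" where
  "D_completion X = lower_Vietoris X (D_completion_points X)"


section \<open>Basic facts\<close>

lemma topspace_lower_Vietoris [simp]: "topspace (lower_Vietoris X \<F>) = \<F>"
  by (simp add: lower_Vietoris_def)

lemma D_completion_eq_sobrification_iff:
  "D_completion X = sobrification X \<longleftrightarrow> D_completion_points X = IRR X"
proof
  assume "D_completion X = sobrification X"
  then have "topspace (D_completion X) = topspace (sobrification X)" by simp
  then show "D_completion_points X = IRR X"
    by (simp add: D_completion_def sobrification_def)
qed (simp add: D_completion_def sobrification_def)

lemma openin_diamond: "openin X U \<Longrightarrow> openin (lower_Vietoris X \<F>) (diamond \<F> U)"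
proof -
  assume U: "openin X U"
  let ?P = "\<lambda>S. \<exists>U. openin X U \<and> S = diamond \<F> U"
  have "?P (diamond \<F> U)" using U by blast
  then have "(finite intersection_of ?P) (diamond \<F> U)"
    by (rule finite_intersection_of_inc)
  then have "(finite intersection_of ?P relative_to \<F>) (\<F> \<inter> diamond \<F> U)"
    by (rule relative_to_inc)
  moreover have "\<F> \<inter> diamond \<F> U = diamond \<F> U"
    by (auto simp: diamond_def)
  ultimately have "(finite intersection_of ?P relative_to \<F>) (diamond \<F> U)" by simp
  then show ?thesis
    unfolding lower_Vietoris_def openin_subbase by (rule arbitrary_union_of_inc)
qed

lemma openin_lower_Vietoris_basis:
  assumes "openin (lower_Vietoris X \<F>) W" "A \<in> W"
  shows "\<exists>\<U>. finite \<U> \<and> (\<forall>U\<in>\<U>. openin X U \<and> A \<inter> U \<noteq> {}) \<and>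
    (\<forall>B\<in>\<F>. (\<forall>U\<in>\<U>. B \<inter> U \<noteq> {}) \<longrightarrow> B \<in> W)"
proof -
  let ?P = "\<lambda>S. \<exists>U. openin X U \<and> S = diamond \<F> U"
  obtain \<W> where \<W>: "\<And>S. S \<in> \<W> \<Longrightarrow> (finite intersection_of ?P relative_to \<F>) S" "\<Union>\<W> = W"
    using assms(1) unfolding lower_Vietoris_def openin_subbase
    by (auto simp: union_of_def)
  then obtain S where S: "S \<in> \<W>" "A \<in> S" using assms(2) by auto
  then obtain \<T> where \<T>: "finite \<T>" "\<And>T. T \<in> \<T> \<Longrightarrow> ?P T" "\<F> \<inter> \<Inter>\<T> = S"
    using \<W>(1)[OF S(1)] by (auto simp: relative_to_def intersection_of_def)
  obtain f where f: "\<And>T. T \<in> \<T> \<Longrightarrow> openin X (f T) \<and> T = diamond \<F> (f T)"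
    using \<T>(2) by metis
  show ?thesis
  proof (intro exI[of _ "f ` \<T>"] conjI ballI impI)
    show "finite (f ` \<T>)" using \<T>(1) by simp
    show "openin X U" if "U \<in> f ` \<T>" for U using that f by auto
    show "A \<inter> U \<noteq> {}" if U: "U \<in> f ` \<T>" for U
    proof -
      obtain T where T: "T \<in> \<T>" "U = f T" using U by auto
      then have "A \<in> diamond \<F> U" using f S(2) \<T>(3) by blast
      then show ?thesis by (simp add: diamond_def)
    qed
    show "B \<in> W" if B: "B \<in> \<F>" "\<forall>U\<in>f ` \<T>. B \<inter> U \<noteq> {}" for B
    proof -
      have "B \<in> T" if "T \<in> \<T>" for T
      proof -
        have "B \<in> diamond \<F> (f T)" using B that by (auto simp: diamond_def)
        then show ?thesis using f[OF that] by simp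
      qed
      then have "B \<in> S" using B(1) \<T>(3) by auto
      then show ?thesis using S(1) \<W>(2) by auto
    qed
  qed
qed

lemma closure_of_lower_Vietoris_directed:
  assumes \<F>: "\<F> \<subseteq> Gamma X" and D: "D \<subseteq> \<F>" "directed_set (\<subseteq>) D"
  shows "lower_Vietoris X \<F> closure_of D = {A\<in>\<F>. A \<subseteq> X closure_of \<Union>D}"
proof (intro equalityI subsetI)
  fix A assume A: "A \<in> lower_Vietoris X \<F> closure_of D"
  then have AF: "A \<in> \<F>" using closure_of_subset_topspace by fastforce
  have "A \<subseteq> X closure_of \<Union>D"
  proof
    fix x assume x: "x \<in> A"
    have xX: "x \<in> topspace X"
      using \<F> AF x by (auto simp: Gamma_def dest!: closedin_subset)
    have "\<exists>y\<in>\<Union>D. y \<in> U" if U: "openin X U" "x \<in> U" for U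
    proof -
      have "A \<in> diamond \<F> U" using AF x U by (auto simp: diamond_def)
      then obtain B where "B \<in> D" "B \<in> diamond \<F> U"
        using A openin_diamond[OF U(1)] unfolding in_closure_of by blast
      then show ?thesis by (auto simp: diamond_def)
    qed
    then show "x \<in> X closure_of \<Union>D" using xX unfolding in_closure_of by blast
  qed
  with AF show "A \<in> {A\<in>\<F>. A \<subseteq> X closure_of \<Union>D}" by simp
next
  fix A assume "A \<in> {A\<in>\<F>. A \<subseteq> X closure_of \<Union>D}"
  then have A: "A \<in> \<F>" "A \<subseteq> X closure_of \<Union>D" by auto
  have "\<exists>B\<in>D. B \<in> W" if W: "openin (lower_Vietoris X \<F>) W" "A \<in> W" for W
  proof -
    obtain \<U> where \<U>: "finite \<U>" "\<forall>U\<in>\<U>. openin X U \<and> A \<inter> U \<noteq> {}"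
      "\<forall>B\<in>\<F>. (\<forall>U\<in>\<U>. B \<inter> U \<noteq> {}) \<longrightarrow> B \<in> W"
      using openin_lower_Vietoris_basis[OF W] by (elim exE conjE)
    have "\<exists>B\<in>D. \<forall>U\<in>\<V>. B \<inter> U \<noteq> {}" if "\<V> \<subseteq> \<U>" for \<V>
      using finite_subset[OF that \<U>(1)] that
    proof (induction \<V> rule: finite_induct)
      case empty
      then show ?case using D(2) by (auto simp: directed_set_def)
    next
      case (insert U \<V>)
      then obtain B where B: "B \<in> D" "\<forall>U\<in>\<V>. B \<inter> U \<noteq> {}" by auto
      obtain x where x: "x \<in> A" "x \<in> U" using \<U>(2) insert.prems by blast
      have "openin X U" using \<U>(2) insert.prems by blast
      moreover have "x \<in> X closure_of \<Union>D" using A(2) x(1) by (rule subsetD)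
      ultimately obtain y C where C: "C \<in> D" "y \<in> C" "y \<in> U"
        using x(2) unfolding in_closure_of by blast
      obtain E where "E \<in> D" "B \<subseteq> E" "C \<subseteq> E"
        using D(2) B(1) C(1) unfolding directed_set_def by blast
      then show ?case using B C by (intro bexI[of _ E]) blast+
    qed
    then obtain B where "B \<in> D" "\<forall>U\<in>\<U>. B \<inter> U \<noteq> {}" by blast
    then show ?thesis using \<U>(3) D(1) by blast
  qed
  then show "A \<in> lower_Vietoris X \<F> closure_of D"
    using A(1) unfolding in_closure_of by auto
qed

lemma closure_of_lower_Vietoris_singleton:
  assumes "\<F> \<subseteq> Gamma X" "B \<in> \<F>"
  shows "lower_Vietoris X \<F> closure_of {B} = {A\<in>\<F>. A \<subseteq> B}"
proof -
  have "closedin X B" using assms by (auto simp: Gamma_def)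
  then have "X closure_of \<Union>{B} = B" by (simp add: closure_of_closedin)
  moreover have "directed_set (\<subseteq>) {B}" by (simp add: directed_set_def)
  moreover have "{B} \<subseteq> \<F>" using assms(2) by simp
  ultimately show ?thesis using closure_of_lower_Vietoris_directed[OF assms(1)] by metis
qed

lemma spec_le_lower_Vietoris:
  assumes "\<F> \<subseteq> Gamma X"
  shows "spec_le (lower_Vietoris X \<F>) A B \<longleftrightarrow> A \<in> \<F> \<and> B \<in> \<F> \<and> A \<subseteq> B"
proof (cases "B \<in> \<F>")
  case True
  show ?thesis
    unfolding spec_le_def topspace_lower_Vietoris closure_of_lower_Vietoris_singleton[OF assms True]
    using True by blast
next
  case False
  then show ?thesis by (simp add: spec_le_def)
qed

lemma is_sup_Gamma:
  assumes "D \<subseteq> Gamma X"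
  shows "is_sup (Gamma X) (\<subseteq>) D (X closure_of \<Union>D)"
proof -
  have "\<Union>D \<subseteq> topspace X" using assms by (auto simp: Gamma_def dest: closedin_subset)
  then have "\<forall>d\<in>D. d \<subseteq> X closure_of \<Union>D" using closure_of_subset[of "\<Union>D" X] by blast
  moreover have "X closure_of \<Union>D \<subseteq> u" if "u \<in> Gamma X" "\<forall>d\<in>D. d \<subseteq> u" for u
    using that by (intro closure_of_minimal) (auto simp: Gamma_def)
  ultimately show ?thesis by (auto simp: is_sup_def Gamma_def)
qed

lemma d_closed_d_closure:
  assumes "B \<subseteq> P"
  shows "d_closed P le (d_closure P le B)"
proof -
  have P: "d_closed P le P" by (auto simp: d_closed_def is_sup_def)
  have "d_closure P le B \<subseteq> P" using P assms by (auto simp: d_closure_def)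
  moreover have "s \<in> d_closure P le B"
    if "D \<subseteq> d_closure P le B" "directed_set le D" "is_sup P le D s" for D s
    unfolding d_closure_def
  proof (rule InterI)
    fix C assume C: "C \<in> {C. d_closed P le C \<and> B \<subseteq> C}"
    then have "D \<subseteq> C" using that(1) by (auto simp: d_closure_def)
    then show "s \<in> C" using C that(2,3) by (auto simp: d_closed_def)
  qed
  ultimately show ?thesis unfolding d_closed_def by blast
qed

lemma subset_d_closure: "B \<subseteq> d_closure P le B"
  by (auto simp: d_closure_def)

theorem is_D_completion_D_completion:
  assumes T0: "t0_space X"
  shows "is_D_completion X (D_completion X) (\<lambda>x. X closure_of {x})"
proof -
  define j where "j = (\<lambda>x. X closure_of {x})"
  define F where "F = D_completion_points X"
  define Y where "Y = lower_Vietoris X F"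
  have jG: "j ` topspace X \<subseteq> Gamma X" by (auto simp: j_def Gamma_def)
  have F_def': "F = d_closure (Gamma X) (\<subseteq>) (j ` topspace X)"
    by (simp add: F_def D_completion_points_def j_def)
  have dF: "d_closed (Gamma X) (\<subseteq>) F"
    unfolding F_def' by (rule d_closed_d_closure[OF jG])
  have FG: "F \<subseteq> Gamma X" using dF by (simp add: d_closed_def)
  have jF: "j ` topspace X \<subseteq> F" unfolding F_def' by (rule subset_d_closure)
  have tY: "topspace Y = F" by (simp add: Y_def)
  note sle = spec_le_lower_Vietoris[OF FG, folded Y_def]
  note cl1 = closure_of_lower_Vietoris_singleton[OF FG, folded Y_def]
  note clD = closure_of_lower_Vietoris_directed[OF FG, folded Y_def]
  have dirD: "directed_set (spec_le Y) D \<longleftrightarrow> directed_set (\<subseteq>) D" if "D \<subseteq> F" for D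
    unfolding directed_set_def sle using that by blast
  have sepY: "A = B" if "A \<in> F" "B \<in> F" "Y closure_of {A} = Y closure_of {B}" for A B
    using that cl1 by blast
  have T0Y: "t0_space Y"
    unfolding t0_space_def
  proof (intro ballI impI)
    fix A B assume "A \<in> topspace Y" "B \<in> topspace Y" "A \<noteq> B"
    then have AB: "A \<in> F" "B \<in> F" "\<not> A \<subseteq> B \<or> \<not> B \<subseteq> A" by (auto simp: tY)
    have *: "\<exists>U. openin Y U \<and> C \<notin> U \<and> E \<in> U" if "C \<in> F" "E \<in> F" "\<not> E \<subseteq> C" for C E
    proof -
      have "closedin X C" "closedin X E" using that FG by (auto simp: Gamma_def)
      then have "openin Y (diamond F (topspace X - C))" "E \<subseteq> topspace X"
        by (auto simp: Y_def closedin_subset intro!: openin_diamond)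
      moreover have "C \<notin> diamond F (topspace X - C)" by (auto simp: diamond_def)
      moreover have "E \<in> diamond F (topspace X - C)"
        using that \<open>E \<subseteq> topspace X\<close> by (auto simp: diamond_def)
      ultimately show ?thesis by blast
    qed
    show "\<exists>U. openin Y U \<and> (A \<notin> U) = (B \<in> U)" using AB *[of A B] *[of B A] by blast
  qed
  have mc: "monotone_convergence_space Y"
    unfolding monotone_convergence_space_def
  proof (intro conjI allI impI T0Y)
    fix D assume D: "D \<subseteq> topspace Y \<and> directed_set (spec_le Y) D"
    then have D': "D \<subseteq> F" "directed_set (\<subseteq>) D" using tY dirD by auto
    define s where "s = X closure_of \<Union>D"
    have "s \<in> F"
      using dF D' is_sup_Gamma[of D X] FG unfolding d_closed_def s_def by blast
    moreover have "Y closure_of D = Y closure_of {s}"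
      using clD[OF D'] cl1[OF \<open>s \<in> F\<close>] by (simp add: s_def)
    ultimately show "\<exists>!s. s \<in> topspace Y \<and> Y closure_of D = Y closure_of {s}"
      using sepY tY by metis
  qed
  have jU: "j x \<inter> U \<noteq> {} \<longleftrightarrow> x \<in> U" if "x \<in> topspace X" "openin X U" for x U
  proof -
    have "x \<in> j x" using that closure_of_subset[of "{x}" X] by (auto simp: j_def)
    moreover have "x \<in> U" if "y \<in> j x" "y \<in> U" for y
      using that \<open>openin X U\<close> by (auto simp: j_def in_closure_of)
    ultimately show ?thesis by blast
  qed
  have inj: "inj_on j (topspace X)"
  proof (rule inj_onI, rule ccontr)
    fix x y assume xy: "x \<in> topspace X" "y \<in> topspace X" "j x = j y" "x \<noteq> y"
    then obtain U where "openin X U" "(x \<notin> U) = (y \<in> U)"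
      using T0 unfolding t0_space_def by blast
    then show False using jU xy by metis
  qed
  have cont: "continuous_map X Y j"
    unfolding Y_def lower_Vietoris_def
  proof (rule continuous_map_into_topology_subbase)
    show "j x \<in> topspace (topology (arbitrary union_of (finite intersection_of
        (\<lambda>S. \<exists>U. openin X U \<and> S = diamond F U) relative_to F)))" if "x \<in> topspace X" for x
      using that jF by auto
    fix V assume "\<exists>U. openin X U \<and> V = diamond F U"
    then obtain U where U: "openin X U" "V = diamond F U" by blast
    have "j x \<in> V \<longleftrightarrow> x \<in> U" if "x \<in> topspace X" for x
      using jU[OF that U(1)] jF that U(2) by (auto simp: diamond_def)
    then have "{x \<in> topspace X. j x \<in> V} = U"
      using openin_subset[OF U(1)] by blast
    then show "openin X {x \<in> topspace X. j x \<in> V}" using U by simp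
  qed
  have emb: "embedding_map X Y j"
    unfolding embedding_map_def
  proof (rule bijective_open_imp_homeomorphic_map)
    show "continuous_map X (subtopology Y (j ` topspace X)) j"
      using cont by (auto simp: continuous_map_in_subtopology)
    show "open_map X (subtopology Y (j ` topspace X)) j"
      unfolding open_map_def
    proof (intro allI impI)
      fix U assume U: "openin X U"
      have "j x \<in> diamond F U \<longleftrightarrow> x \<in> U" if "x \<in> topspace X" for x
        using jU[OF that U] jF that by (auto simp: diamond_def)
      then have "j ` U = diamond F U \<inter> j ` topspace X"
        using openin_subset[OF U] by blast
      moreover have "openin Y (diamond F U)" unfolding Y_def by (rule openin_diamond[OF U])
      ultimately show "openin (subtopology Y (j ` topspace X)) (j ` U)"
        unfolding openin_subtopology by blast
    qed
    show "j ` topspace X = topspace (subtopology Y (j ` topspace X))"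
      using jF tY by (auto simp: topspace_subtopology)
    show "inj_on j (topspace X)" by (rule inj)
  qed
  have "F \<subseteq> C" if C: "d_closed F (spec_le Y) C" "j ` topspace X \<subseteq> C" for C
  proof -
    have CF: "C \<subseteq> F" using C by (simp add: d_closed_def)
    have "s \<in> C" if D: "D \<subseteq> C" "directed_set (\<subseteq>) D" "is_sup (Gamma X) (\<subseteq>) D s" for D s
    proof -
      have "D \<subseteq> F" using D CF by blast
      then have "s \<in> F" using dF D unfolding d_closed_def by blast
      have "d \<subseteq> s" if "d \<in> D" for d using D(3) that unfolding is_sup_def by blast
      moreover have "s \<subseteq> u" if "u \<in> F" "\<forall>d\<in>D. d \<subseteq> u" for u
        using D(3) that FG unfolding is_sup_def by blast
      ultimately have "is_sup F (spec_le Y) D s"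
        using \<open>s \<in> F\<close> \<open>D \<subseteq> F\<close> unfolding is_sup_def sle by blast
      moreover have "directed_set (spec_le Y) D" using D(2) dirD[OF \<open>D \<subseteq> F\<close>] by simp
      ultimately show ?thesis using C(1) D(1) unfolding d_closed_def by blast
    qed
    moreover have "C \<subseteq> Gamma X" using CF FG by (rule subset_trans)
    ultimately have "d_closed (Gamma X) (\<subseteq>) C" unfolding d_closed_def by blast
    then show ?thesis using C(2) unfolding F_def' d_closure_def by blast
  qed
  moreover have "d_closed F (spec_le Y) F" by (auto simp: d_closed_def is_sup_def)
  ultimately have "d_closure F (spec_le Y) (j ` topspace X) = F"
    using jF unfolding d_closure_def by (intro equalityI Inter_lower Inter_greatest) auto
  then have "is_D_completion X Y j"
    using mc emb unfolding is_D_completion_def tY by blast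
  then show ?thesis unfolding Y_def F_def D_completion_def j_def .
qed

end

theory Submission
  imports Defs
begin

text \<open>The content of the theorem is that every irreducible closed set \<open>A\<close> is directed in the
  specialization order: then \<open>A\<close> is the supremum in \<^term>\<open>Gamma X\<close> of the directed family of the
  point closures \<open>cl {a}\<close> with \<open>a \<in> A\<close>, so it lies in their d-closure. Conversely, the d-closure
  consists of irreducible sets because directed suprema of irreducible closed sets are irreducible.

  To see that \<open>A\<close> is directed, consider the compact saturated sets whose interior meets \<open>A\<close>.
  By irreducibility and local compactness they form a filtered family, and \<open>A\<close> is minimal among the
  closed sets hitting all of them; in particular \<open>A\<close> is a \<open>KF\<close>-set, and the closedness hypothesis
  applies to it. For \<open>K\<close> in the family, the closed set \<open>\<down>(K \<inter> A)\<close> still hits every member, so it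
  is \<open>A\<close> by minimality: every neighbourhood of a point of \<open>A\<close> contains, above each
  point of \<open>A\<close>, a point of \<open>A\<close>. Now let \<open>x, y \<in> A\<close>. The principal filter \<open>\<up>x\<close> is compact
  and saturated, so \<open>\<down>(\<up>x \<inter> A)\<close> is closed. If \<open>y\<close> were outside this set, the complement of
  the set would be a neighbourhood of \<open>y\<close> and so contain a point of \<open>\<up>x \<inter> A\<close>, which is absurd.
  So \<open>y\<close> lies below a point of \<open>A\<close> that is above \<open>x\<close>.\<close>

lemma spec_le_refl: "x \<in> topspace X \<Longrightarrow> spec_le X x x"
  by (auto simp: spec_le_def in_closure_of)

lemma spec_le_openin: "spec_le X x y \<Longrightarrow> openin X U \<Longrightarrow> x \<in> U \<Longrightarrow> y \<in> U"
  by (auto simp: spec_le_def in_closure_of)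

lemma spec_le_trans: "spec_le X x y \<Longrightarrow> spec_le X y z \<Longrightarrow> spec_le X x z"
  by (auto simp: spec_le_def in_closure_of)

lemma spec_le_iff_closure_subset:
  assumes "x \<in> topspace X" "y \<in> topspace X"
  shows "spec_le X x y \<longleftrightarrow> X closure_of {x} \<subseteq> X closure_of {y}"
  using assms by (auto simp: spec_le_def in_closure_of)

lemma down_subset_closedin:
  assumes "closedin X A" "S \<subseteq> A"
  shows "down X S \<subseteq> A"
proof
  fix x assume "x \<in> down X S"
  then obtain a where "a \<in> A" "x \<in> X closure_of {a}"
    using assms(2) by (auto simp: down_def spec_le_def)
  then show "x \<in> A"
    using closure_of_minimal[OF _ assms(1), of "{a}"] by auto
qed

lemma subset_down: "S \<subseteq> topspace X \<Longrightarrow> S \<subseteq> down X S"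
  using spec_le_refl by (fastforce simp: down_def)

text \<open>A principal filter is compact because any open set containing its least element contains
  all of it.\<close>

lemma up_singleton_in_Q:
  assumes "x \<in> topspace X"
  shows "up X {x} \<in> Q X"
proof -
  have "compactin X (up X {x})"
    unfolding compactin_def
  proof (intro conjI allI impI)
    show "up X {x} \<subseteq> topspace X" by (auto simp: up_def spec_le_def)
    fix \<U> assume \<U>: "Ball \<U> (openin X) \<and> up X {x} \<subseteq> \<Union>\<U>"
    have "x \<in> up X {x}" using spec_le_refl[OF assms] by (simp add: up_def)
    then obtain U where U: "U \<in> \<U>" "x \<in> U" using \<U> by blast
    then have "up X {x} \<subseteq> U" using \<U> spec_le_openin by (fastforce simp: up_def)
    then show "\<exists>\<F>. finite \<F> \<and> \<F> \<subseteq> \<U> \<and> up X {x} \<subseteq> \<Union>\<F>"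
      using U(1) by (intro exI[of _ "{U}"]) auto
  qed
  moreover have "up X {x} = up X (up X {x})"
  proof
    show "up X {x} \<subseteq> up X (up X {x})"
    proof
      fix y assume y: "y \<in> up X {x}"
      then have "spec_le X y y" by (intro spec_le_refl) (auto simp: up_def spec_le_def)
      then show "y \<in> up X (up X {x})" using y unfolding up_def by blast
    qed
    show "up X (up X {x}) \<subseteq> up X {x}"
      by (auto simp: up_def intro: spec_le_trans)
  qed
  ultimately show ?thesis by (simp add: Q_def)
qed

lemma IRR_openin_Int:
  assumes "A \<in> IRR X" "openin X U" "openin X V" "A \<inter> U \<noteq> {}" "A \<inter> V \<noteq> {}"
  shows "A \<inter> (U \<inter> V) \<noteq> {}"
proof
  assume "A \<inter> (U \<inter> V) = {}"
  moreover have "A \<subseteq> topspace X" using assms(1) by (auto simp: IRR_def dest: closedin_subset)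
  ultimately have "A \<subseteq> (topspace X - U) \<union> (topspace X - V)" by blast
  then have "A \<subseteq> topspace X - U \<or> A \<subseteq> topspace X - V"
    using assms(1-3) unfolding IRR_def by blast
  then show False using assms(4,5) by blast
qed

lemma filtered_compact_neighbourhoods_IRR:
  assumes lc: "locally_compact_sat X" and A: "A \<in> IRR X"
  shows "filtered_family X {K\<in>Q X. A \<inter> X interior_of K \<noteq> {}}"
proof -
  have clA: "A \<subseteq> topspace X" "A \<noteq> {}" using A by (auto simp: IRR_def dest: closedin_subset)
  have small: "\<exists>K\<in>Q X. A \<inter> X interior_of K \<noteq> {} \<and> K \<subseteq> U"
    if "openin X U" "A \<inter> U \<noteq> {}" for U
    using that lc clA unfolding locally_compact_sat_def by blast
  have "\<exists>K\<in>Q X. A \<inter> X interior_of K \<noteq> {} \<and> K \<subseteq> topspace X"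
    using clA by (intro small) auto
  then have "{K\<in>Q X. A \<inter> X interior_of K \<noteq> {}} \<noteq> {}" by auto
  moreover have "\<exists>K\<in>Q X. A \<inter> X interior_of K \<noteq> {} \<and> K \<subseteq> K1 \<inter> K2"
    if "A \<inter> X interior_of K1 \<noteq> {}" "A \<inter> X interior_of K2 \<noteq> {}" for K1 K2
  proof -
    have "A \<inter> (X interior_of K1 \<inter> X interior_of K2) \<noteq> {}"
      using that by (intro IRR_openin_Int[OF A]) auto
    then obtain K where "K \<in> Q X" "A \<inter> X interior_of K \<noteq> {}"
        "K \<subseteq> X interior_of K1 \<inter> X interior_of K2"
      using small[of "X interior_of K1 \<inter> X interior_of K2"] by (meson openin_Int openin_interior_of)
    then show ?thesis using interior_of_subset[of X K1] interior_of_subset[of X K2] by blast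
  qed
  ultimately show ?thesis unfolding filtered_family_def by (simp add: Bex_def)
qed

text \<open>Minimality holds since a point of \<open>A\<close> outside a closed set \<open>B\<close> has a compact neighbourhood
  that misses \<open>B\<close>.\<close>

lemma minimal_hitting_compact_neighbourhoods:
  assumes lc: "locally_compact_sat X" and A: "closedin X A"
  shows "minimal_hitting X {K\<in>Q X. A \<inter> X interior_of K \<noteq> {}} A"
proof -
  have "A \<subseteq> B" if B: "closedin X B" "\<forall>K\<in>{K\<in>Q X. A \<inter> X interior_of K \<noteq> {}}. B \<inter> K \<noteq> {}" for B
  proof (rule ccontr)
    assume "\<not> A \<subseteq> B"
    then obtain x where x: "x \<in> A" "x \<notin> B" by blast
    then have "x \<in> topspace X - B" using closedin_subset[OF A] by blast
    moreover have "openin X (topspace X - B)" using B(1) by blast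
    ultimately obtain K where "K \<in> Q X" "x \<in> X interior_of K" "K \<subseteq> topspace X - B"
      using lc unfolding locally_compact_sat_def by blast
    then show False using x(1) B(2) by blast
  qed
  moreover have "A \<inter> K \<noteq> {}" if "A \<inter> X interior_of K \<noteq> {}" for K
    using that interior_of_subset[of X K] by blast
  ultimately show ?thesis using A unfolding minimal_hitting_def by blast
qed

lemma IRR_subset_KF:
  assumes "locally_compact_sat X"
  shows "IRR X \<subseteq> KF X"
proof
  fix A assume A: "A \<in> IRR X"
  then have cl: "closedin X A" "A \<noteq> {}" by (auto simp: IRR_def)
  then have "X closure_of A = A" by (simp add: closure_of_closedin)
  then show "A \<in> KF X"
    using cl closedin_subset[OF cl(1)] filtered_compact_neighbourhoods_IRR[OF assms A]
      minimal_hitting_compact_neighbourhoods[OF assms cl(1)]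
    unfolding KF_def KF_set_def by auto
qed

text \<open>Filteredness keeps \<open>\<down>(K \<inter> A)\<close> among the sets hitting all of \<open>\<K>\<close>, so a minimal such \<open>A\<close>
  cannot be larger.\<close>

lemma down_Int_minimal_hitting:
  assumes \<K>: "filtered_family X \<K>" and min: "minimal_hitting X \<K> A"
    and K: "K \<in> \<K>" and cl: "closedin X (down X (K \<inter> A))"
  shows "down X (K \<inter> A) = A"
proof -
  have A: "closedin X A" using min by (simp add: minimal_hitting_def)
  have "K \<inter> A \<subseteq> down X (K \<inter> A)"
    using closedin_subset[OF A] by (intro subset_down) blast
  moreover have "\<exists>a. a \<in> A \<and> a \<in> K \<and> a \<in> L" if L: "L \<in> \<K>" for L
  proof -
    obtain J where "J \<in> \<K>" "J \<subseteq> K \<inter> L" using \<K> K L unfolding filtered_family_def by blast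
    then show ?thesis using min unfolding minimal_hitting_def by blast
  qed
  ultimately have "\<forall>L\<in>\<K>. down X (K \<inter> A) \<inter> L \<noteq> {}" by blast
  moreover have "down X (K \<inter> A) \<subseteq> A" using A by (rule down_subset_closedin) blast
  ultimately show ?thesis using min cl unfolding minimal_hitting_def by blast
qed

text \<open>The hypothesis is used twice: for the compact neighbourhoods of \<open>y\<close>, to find points of \<open>A\<close> above
  \<open>x\<close> near \<open>y\<close>, and for the principal filter of \<open>x\<close>, to conclude that \<open>y\<close>, being a limit of such
  points, is below one of them.\<close>

lemma directed_set_IRR:
  assumes lc: "locally_compact_sat X" and A: "A \<in> IRR X"
    and cl: "\<And>K. K \<in> Q X \<Longrightarrow> closedin X (down X (K \<inter> A))"
  shows "directed_set (spec_le X) A"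
  unfolding directed_set_def
proof (intro conjI ballI)
  have clA: "closedin X A" using A by (simp add: IRR_def)
  then have AX: "A \<subseteq> topspace X" by (rule closedin_subset)
  show "A \<noteq> {}" using A by (simp add: IRR_def)
  fix x y assume x: "x \<in> A" and y: "y \<in> A"
  let ?B = "down X (up X {x} \<inter> A)"
  have clB: "closedin X ?B" using x AX by (intro cl up_singleton_in_Q) blast
  have "y \<in> ?B"
  proof (rule ccontr)
    assume "y \<notin> ?B"
    then have "y \<in> topspace X - ?B" using y AX by blast
    moreover have "openin X (topspace X - ?B)" using clB by blast
    ultimately obtain K where K: "K \<in> Q X" "y \<in> X interior_of K" "K \<subseteq> topspace X - ?B"
      using lc unfolding locally_compact_sat_def by blast
    have "down X (K \<inter> A) = A"
      using K(1,2) y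
      by (intro down_Int_minimal_hitting[OF filtered_compact_neighbourhoods_IRR[OF lc A]
            minimal_hitting_compact_neighbourhoods[OF lc clA]] cl) auto
    then obtain k where k: "k \<in> K" "k \<in> A" "spec_le X x k"
      using x by (auto simp: down_def)
    then have "k \<in> up X {x} \<inter> A" by (simp add: up_def)
    moreover have "up X {x} \<inter> A \<subseteq> ?B" using AX by (intro subset_down) blast
    ultimately show False using k(1) K(3) by blast
  qed
  then show "\<exists>z\<in>A. spec_le X x z \<and> spec_le X y z"
    by (auto simp: down_def up_def)
qed

text \<open>A closed directed set is the union of the closures of its points, hence their supremum.\<close>

lemma directed_closedin_in_D_completion_points:
  assumes A: "closedin X A" and dir: "directed_set (spec_le X) A"
  shows "A \<in> D_completion_points X"
proof -
  let ?j = "\<lambda>x. X closure_of {x}"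
  have AX: "A \<subseteq> topspace X" using A by (rule closedin_subset)
  have jG: "?j ` topspace X \<subseteq> Gamma X" by (auto simp: Gamma_def)
  have "?j ` A \<subseteq> D_completion_points X"
    using AX subset_d_closure[of "?j ` topspace X" "Gamma X" "(\<subseteq>)"]
    unfolding D_completion_points_def by blast
  moreover have "directed_set (\<subseteq>) (?j ` A)"
    unfolding directed_set_def
  proof (intro conjI ballI)
    show "?j ` A \<noteq> {}" using dir by (auto simp: directed_set_def)
    fix B C assume "B \<in> ?j ` A" "C \<in> ?j ` A"
    then obtain x y where xy: "x \<in> A" "y \<in> A" "B = ?j x" "C = ?j y" by blast
    then obtain z where z: "z \<in> A" "spec_le X x z" "spec_le X y z"
      using dir unfolding directed_set_def by blast
    then have "B \<subseteq> ?j z" "C \<subseteq> ?j z"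
      using xy by (simp_all add: spec_le_iff_closure_subset subsetD[OF AX])
    then show "\<exists>E\<in>?j ` A. B \<subseteq> E \<and> C \<subseteq> E" using z(1) by blast
  qed
  moreover have "is_sup (Gamma X) (\<subseteq>) (?j ` A) A"
  proof -
    have "?j a \<subseteq> A" if "a \<in> A" for a using that by (intro closure_of_minimal A) auto
    moreover have "a \<in> ?j a" if "a \<in> A" for a
      using that AX closure_of_subset[of "{a}" X] by auto
    ultimately have "\<Union>(?j ` A) = A" by blast
    then show ?thesis
      using is_sup_Gamma[of "?j ` A" X] jG AX A by (auto simp: closure_of_closedin Gamma_def)
  qed
  ultimately show ?thesis
    using d_closed_d_closure[OF jG, of "(\<subseteq>)"]
    unfolding D_completion_points_def d_closed_def by blast
qed

lemma closure_of_singleton_in_IRR: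
  assumes "x \<in> topspace X"
  shows "X closure_of {x} \<in> IRR X"
proof -
  have x: "x \<in> X closure_of {x}" using assms closure_of_subset[of "{x}" X] by auto
  have "X closure_of {x} \<subseteq> B" if "closedin X B" "x \<in> B" for B
    using that by (intro closure_of_minimal) auto
  then have "X closure_of {x} \<subseteq> B \<or> X closure_of {x} \<subseteq> C"
    if "closedin X B" "closedin X C" "X closure_of {x} \<subseteq> B \<union> C" for B C
    using that x by (meson UnE subsetD)
  then show ?thesis using x unfolding IRR_def by auto
qed

text \<open>If \<open>D\<close> lies in \<open>B \<union> C\<close> but some member is not in \<open>B\<close> and some member is not in \<open>C\<close>, then a
  common upper bound in \<open>D\<close> is in neither, against its irreducibility.\<close>

lemma closure_of_Union_directed_in_IRR:
  assumes D: "D \<subseteq> IRR X" "directed_set (\<subseteq>) D"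
  shows "X closure_of \<Union>D \<in> IRR X"
proof -
  have sub: "\<Union>D \<subseteq> X closure_of \<Union>D"
    using D(1) by (intro closure_of_subset) (fastforce simp: IRR_def dest: closedin_subset)
  obtain E where "E \<in> D" using D(2) by (auto simp: directed_set_def)
  moreover have "E \<noteq> {}" using \<open>E \<in> D\<close> D(1) by (auto simp: IRR_def)
  ultimately have "X closure_of \<Union>D \<noteq> {}" using sub by blast
  moreover have "X closure_of \<Union>D \<subseteq> B \<or> X closure_of \<Union>D \<subseteq> C"
    if BC: "closedin X B" "closedin X C" "X closure_of \<Union>D \<subseteq> B \<union> C" for B C
  proof -
    have part: "E \<subseteq> B \<or> E \<subseteq> C" if "E \<in> D" for E
    proof -
      have "E \<subseteq> B \<union> C" using that BC(3) sub by blast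
      moreover have "E \<in> IRR X" using that D(1) by blast
      ultimately show ?thesis using BC(1,2) by (simp add: IRR_def)
    qed
    have "\<Union>D \<subseteq> B \<or> \<Union>D \<subseteq> C"
    proof (rule ccontr)
      assume "\<not> (\<Union>D \<subseteq> B \<or> \<Union>D \<subseteq> C)"
      then obtain F G where FG: "F \<in> D" "\<not> F \<subseteq> B" "G \<in> D" "\<not> G \<subseteq> C" by blast
      then obtain H where "H \<in> D" "F \<subseteq> H" "G \<subseteq> H"
        using D(2) unfolding directed_set_def by meson
      then show False using part[of H] FG(2,4) by blast
    qed
    then show ?thesis using BC by (meson closure_of_minimal)
  qed
  ultimately show ?thesis by (simp add: IRR_def)
qed

lemma D_completion_points_subset_IRR: "D_completion_points X \<subseteq> IRR X"
proof -
  have G: "IRR X \<subseteq> Gamma X" by (auto simp: IRR_def Gamma_def)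
  have "s \<in> IRR X"
    if D: "D \<subseteq> IRR X" "directed_set (\<subseteq>) D" "is_sup (Gamma X) (\<subseteq>) D s" for D s
  proof -
    have "is_sup (Gamma X) (\<subseteq>) D (X closure_of \<Union>D)"
      using D(1) G by (intro is_sup_Gamma) blast
    then have "s = X closure_of \<Union>D"
      using D(3) unfolding is_sup_def by (intro equalityI) simp_all
    then show ?thesis using closure_of_Union_directed_in_IRR[OF D(1,2)] by simp
  qed
  then have "d_closed (Gamma X) (\<subseteq>) (IRR X)" using G unfolding d_closed_def by blast
  then show ?thesis
    using closure_of_singleton_in_IRR[of _ X]
    unfolding D_completion_points_def d_closure_def by (intro Inter_lower) auto
qed

theorem theorem3p2:
  fixes X :: "'a topology"
  assumes "t0_space X"
    and "locally_compact_sat X"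
    and "\<And>A K. A \<in> KF X \<Longrightarrow> K \<in> Q X \<Longrightarrow> closedin X (down X (K \<inter> A))"
  shows "D_completion X = sobrification X"
proof -
  have "A \<in> D_completion_points X" if A: "A \<in> IRR X" for A
  proof -
    have "A \<in> KF X" using A IRR_subset_KF[OF assms(2)] by blast
    then have "directed_set (spec_le X) A"
      using directed_set_IRR[OF assms(2) A] assms(3) by blast
    moreover have "closedin X A" using A by (simp add: IRR_def)
    ultimately show ?thesis by (intro directed_closedin_in_D_completion_points)
  qed
  then have "D_completion_points X = IRR X" using D_completion_points_subset_IRR by blast
  then show ?thesis by (simp add: D_completion_eq_sobrification_iff)
qed

end
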